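(* Let $n\ge 2$ and $1\le m\le|\mathbf{coN}(n)|$. Let $\alpha_1,\alpha_2,\ldots,\alpha_m$ be the first $m$ strings of $\mathbf{coN}(n)$ when it is listed in reverse colexicographic order. Then $\text{UC}(\alpha_1,\ldots,\alpha_m)=pr(\alpha_1)pr(\alpha_2)\cdots pr(\alpha_m)$ is a universal cycle for $\mathbf{S}=\bigcup_{i=1}^m\mathbf{sub}_n(\alpha_i)$.
   Context: Strings are binary, over $\{0,1\}$; $\Sigma_2^n$ is the set of binary strings of length $n$. For a binary string $\alpha$, $\overline{\alpha}$ is its bitwise complement. A necklace is a string that is lexicographically smallest among all its rotations. A binary string $\alpha$ of length $n$ is a co-necklace if $\alpha\overline{\alpha}$ is a necklace; $\mathbf{coN}(n)=\{\alpha\overline{\alpha}:\alpha \text{ a co-necklace of length } n\}$. Colexicographic order on strings of equal length: $a_1\cdots a_\ell$ precedes $b_1\cdots b_\ell$ if $a_i<b_i$ at the largest $i$ with $a_i\ne b_i$; reverse colexicographic order is its reverse. The periodic reduction $pr(a_1\cdots a_\ell)$ is $a_1\cdots a_p$ where $p$ is the smallest integer with $a_1\cdots a_\ell=(a_1\cdots a_p)^{\ell/p}$. For a string $\alpha$, $\mathbf{sub}_n(\alpha)$ is the set of all length-$n$ substrings of $\alpha$ viewed as a cyclic string (windows may wrap around). For a nonempty $\mathbf{S}\subseteq\Sigma_2^n$, a universal cycle for $\mathbf{S}$ is a string of length $|\mathbf{S}|$ which, viewed cyclically, contains every string of $\mathbf{S}$ as a length-$n$ substring exactly once. *)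

theory Defs
  imports Main "HOL-Library.List_Lexorder"
begin

(* Binary strings are bool lists, with False for 0 and True for 1; the comparison of lists
   in the next definition is the lexicographic order of HOL-Library.List_Lexorder. *)

definition necklace :: "bool list \<Rightarrow> bool" where
  "necklace \<alpha> \<longleftrightarrow> (\<forall>k. \<alpha> \<le> rotate k \<alpha>)"

definition complement :: "bool list \<Rightarrow> bool list" where
  "complement \<alpha> = map Not \<alpha>"

definition co_necklace :: "bool list \<Rightarrow> bool" where
  "co_necklace \<alpha> \<longleftrightarrow> necklace (\<alpha> @ complement \<alpha>)"

definition coN :: "nat \<Rightarrow> bool list set" where
  "coN n = {\<alpha> @ complement \<alpha> | \<alpha>. length \<alpha> = n \<and> co_necklace \<alpha>}"

definition colex_less :: "bool list \<Rightarrow> bool list \<Rightarrow> bool" where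
  "colex_less a b \<longleftrightarrow> length a = length b \<and>
     (\<exists>i<length a. a ! i < b ! i \<and> (\<forall>j. i < j \<and> j < length a \<longrightarrow> a ! j = b ! j))"

definition rev_colex_listing :: "bool list set \<Rightarrow> bool list list \<Rightarrow> bool" where
  "rev_colex_listing A L \<longleftrightarrow> set L = A \<and> sorted_wrt (\<lambda>x y. colex_less y x) L"

definition pr :: "bool list \<Rightarrow> bool list" where
  "pr \<alpha> = take (LEAST p. 0 < p \<and> p dvd length \<alpha> \<and>
                     \<alpha> = concat (replicate (length \<alpha> div p) (take p \<alpha>))) \<alpha>"

definition cyc_window :: "nat \<Rightarrow> bool list \<Rightarrow> nat \<Rightarrow> bool list" where
  "cyc_window n w i = map (\<lambda>j. w ! ((i + j) mod length w)) [0..<n]"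

definition cyc_sub :: "nat \<Rightarrow> bool list \<Rightarrow> bool list set" where
  "cyc_sub n \<alpha> = cyc_window n \<alpha> ` {..<length \<alpha>}"

definition universal_cycle :: "nat \<Rightarrow> bool list set \<Rightarrow> bool list \<Rightarrow> bool" where
  "universal_cycle n S w \<longleftrightarrow>
     S \<noteq> {} \<and> S \<subseteq> {s. length s = n} \<and> length w = card S \<and>
     (\<forall>s\<in>S. \<exists>!i. i < length w \<and> cyc_window n w i = s)"

definition UC :: "bool list list \<Rightarrow> bool list" where
  "UC \<alpha>s = concat (map pr \<alpha>s)"

(* The reverse colexicographic listing of coN n exists and is unique, so a theorem that
   assumes rev_colex_listing (coN n) L speaks about exactly one list L. *)

lemma colex_less_iff_rev:
  assumes "length a = length b"
  shows "colex_less a b \<longleftrightarrow> rev a < rev b"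
  using assms
proof (induction a arbitrary: b rule: rev_induct)
  case Nil
  then show ?case by (simp add: colex_less_def)
next
  case (snoc x xs)
  obtain ys y where b: "b = ys @ [y]"
    using snoc.prems by (cases b rule: rev_cases) auto
  have len: "length xs = length ys" using snoc.prems b by simp
  have "colex_less (xs @ [x]) (ys @ [y]) \<longleftrightarrow> x < y \<or> x = y \<and> colex_less xs ys"
    (is "?l \<longleftrightarrow> ?r")
  proof
    assume ?l
    then obtain i where i: "i \<le> length xs" "(xs @ [x]) ! i < (ys @ [y]) ! i"
      "\<And>j. i < j \<Longrightarrow> j \<le> length xs \<Longrightarrow> (xs @ [x]) ! j = (ys @ [y]) ! j"
      by (auto simp: colex_less_def less_Suc_eq_le)
    show ?r
    proof (cases "i = length xs")
      case True
      then show ?thesis using i(2) len by (simp add: nth_append)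
    next
      case False
      then have il: "i < length xs" using i(1) by simp
      have "x = y" using i(3)[OF il] len by (simp add: nth_append)
      moreover have "xs ! i < ys ! i" using i(2) il len by (simp add: nth_append)
      moreover have "xs ! j = ys ! j" if "i < j" "j < length xs" for j
        using i(3)[of j] that len by (simp add: nth_append)
      ultimately show ?thesis using il len by (auto simp: colex_less_def)
    qed
  next
    assume ?r
    then show ?l
    proof
      assume "x < y"
      then show ?l using len
        by (auto simp: colex_less_def nth_append intro!: exI[of _ "length xs"])
    next
      assume *: "x = y \<and> colex_less xs ys"
      then obtain i where i: "i < length xs" "xs ! i < ys ! i"
        "\<And>j. i < j \<Longrightarrow> j < length xs \<Longrightarrow> xs ! j = ys ! j"
        by (auto simp: colex_less_def)
      show ?l
        unfolding colex_less_def
      proof (intro conjI exI[of _ i] allI impI)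
        fix j assume "i < j \<and> j < length (xs @ [x])"
        then show "(xs @ [x]) ! j = (ys @ [y]) ! j"
          using i(3)[of j] * len by (cases "j = length xs") (auto simp: nth_append)
      qed (use i len in \<open>auto simp: nth_append\<close>)
    qed
  qed
  then show ?case using b snoc.IH[OF len] by auto
qed

lemma length_coN: "x \<in> coN n \<Longrightarrow> length x = 2 * n"
  by (auto simp: coN_def complement_def)

lemma finite_coN: "finite (coN n)"
proof (rule finite_subset)
  show "coN n \<subseteq> {xs. set xs \<subseteq> UNIV \<and> length xs = 2 * n}" using length_coN by auto
  show "finite {xs :: bool list. set xs \<subseteq> UNIV \<and> length xs = 2 * n}"
    by (rule finite_lists_length_eq) simp
qed

lemma rev_colex_listing_coN_iff:
  "rev_colex_listing (coN n) L \<longleftrightarrow> set L = coN n \<and> sorted_wrt (<) (map rev (rev L))"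
proof -
  have "sorted_wrt (\<lambda>x y. colex_less y x) L \<longleftrightarrow> sorted_wrt (\<lambda>x y. rev y < rev x) L"
    if "set L = coN n"
  proof -
    have "colex_less y x \<longleftrightarrow> rev y < rev x" if "x \<in> set L" "y \<in> set L" for x y
      using that \<open>set L = coN n\<close> length_coN by (intro colex_less_iff_rev) auto
    then show ?thesis by (auto simp: sorted_wrt_iff_nth_less)
  qed
  then show ?thesis
    by (auto simp: rev_colex_listing_def sorted_wrt_map sorted_wrt_rev)
qed

lemma ex1_rev_colex_listing_coN: "\<exists>!L. rev_colex_listing (coN n) L"
proof (rule ex_ex1I)
  let ?M = "sorted_list_of_set (rev ` coN n)"
  have "set (rev (map rev ?M)) = coN n" by (simp add: finite_coN image_image)
  moreover have "sorted_wrt (<) (map rev (rev (rev (map rev ?M))))"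
    by (simp add: comp_def)
  ultimately show "\<exists>L. rev_colex_listing (coN n) L"
    using rev_colex_listing_coN_iff by blast
next
  fix L L'
  assume "rev_colex_listing (coN n) L" "rev_colex_listing (coN n) L'"
  then have "set (map rev (rev L)) = set (map rev (rev L'))"
    "sorted_wrt (<) (map rev (rev L))" "sorted_wrt (<) (map rev (rev L'))"
    by (auto simp: rev_colex_listing_coN_iff)
  then have "map rev (rev L) = map rev (rev L')" by (metis strict_sorted_equal)
  then show "L = L'" by (simp add: inj_map_eq_map)
qed

end

theory Submission imports Defs begin

text \<open>
  A window of length \<open>n\<close> determines the cyclic word of an element of \<open>coN n\<close>, because entries
  at distance \<open>n\<close> are complementary. Hence distinct elements have disjoint sets of windows, the
  windows of \<open>\<alpha>\<close> starting inside \<open>pr \<alpha>\<close> are distinct, and the cycle has at most as many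
  positions as there are words to cover. It remains to see that every word occurs.

  This is proved by appending the \<open>pr \<alpha>\<^sub>m\<close> one at a time. If \<open>\<alpha>\<^sub>m\<close> starts with
  \<open>0\<^sup>j1\<close>, then changing this 1 to 0 (and the complementary entry to 1) gives again an element
  of \<open>coN n\<close>, which is listed earlier. So \<open>\<alpha>\<^sub>m\<close> and its predecessor in the list agree on the
  last \<open>n - 1 - j\<close> entries. As the cycle starts with \<open>0\<^sup>n\<close>, it shares with \<open>\<alpha>\<^sub>m\<close> a word of
  length \<open>n - 1\<close> across the seam, and joining two cycles at such a word keeps all their windows.
\<close>

section \<open>Cyclic indexing\<close>

text \<open>Integer positions let the letters just before the seam of a cycle be addressed by
  negative indices.\<close>

definition cyc_nth :: "'a list \<Rightarrow> int \<Rightarrow> 'a" where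
  "cyc_nth w k = w ! nat (k mod int (length w))"

definition has_period :: "(int \<Rightarrow> 'a) \<Rightarrow> int \<Rightarrow> bool" where
  "has_period f d \<longleftrightarrow> (\<forall>k. f (k + d) = f k)"

lemma has_periodD: "has_period f d \<Longrightarrow> f (k + d) = f k"
  by (simp add: has_period_def)

lemma has_period_uminus: "has_period f d \<Longrightarrow> has_period f (- d)"
  unfolding has_period_def by (metis diff_add_cancel uminus_add_conv_diff add.commute)

lemma has_period_add: "has_period f d \<Longrightarrow> has_period f e \<Longrightarrow> has_period f (d + e)"
  unfolding has_period_def by (metis add.assoc)

lemma has_period_mult:
  assumes "has_period f d"
  shows "has_period f (c * d)"
proof -
  have nat: "has_period f (int m * d)" for m
  proof (induction m)
    case 0
    then show ?case by (simp add: has_period_def)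
  next
    case (Suc m)
    then show ?case using has_period_add[OF assms Suc] by (simp add: algebra_simps)
  qed
  show ?thesis
    using nat[of "nat c"] has_period_uminus[OF nat[of "nat (- c)"]] by (cases "c \<ge> 0") auto
qed

text \<open>The periods of a function on the integers form a subgroup, so Bezout's identity puts the
  gcd among them.\<close>

lemma has_period_gcd:
  assumes "has_period f d" "has_period f e"
  shows "has_period f (gcd d e)"
proof -
  obtain x y where "x * d + y * e = gcd d e" using bezout_int by blast
  then show ?thesis
    using has_period_add[OF has_period_mult[OF assms(1)] has_period_mult[OF assms(2)]] by metis
qed

lemma has_period_mod:
  assumes "has_period f d"
  shows "f (k mod d) = f k"
  using has_periodD[OF has_period_mult[OF assms, of "k div d"], of "k mod d"] by simp

lemma has_period_length: "has_period (cyc_nth w) (int (length w))"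
  by (simp add: has_period_def cyc_nth_def)

lemma cyc_nth_nth: "0 \<le> k \<Longrightarrow> k < int (length w) \<Longrightarrow> cyc_nth w k = w ! nat k"
  by (simp add: cyc_nth_def)

lemma cyc_nth_of_nat: "k < length w \<Longrightarrow> cyc_nth w (int k) = w ! k"
  by (simp add: cyc_nth_nth)

lemma cyc_window_conv_cyc_nth:
  "cyc_window n w i = map (\<lambda>j. cyc_nth w (int i + int j)) [0..<n]"
  by (simp add: cyc_window_def cyc_nth_def flip: of_nat_add zmod_int)

lemma map_cyc_nth_in_cyc_sub:
  assumes "w \<noteq> []"
  shows "map (\<lambda>j. cyc_nth w (k + int j)) [0..<n] \<in> cyc_sub n w"
proof -
  let ?l = "int (length w)"
  let ?i = "nat (k mod ?l)"
  have l: "?l > 0" using assms by simp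
  have "cyc_nth w (int ?i + int j) = cyc_nth w (k + int j)" for j
    using l by (simp add: cyc_nth_def mod_simps)
  then have "map (\<lambda>j. cyc_nth w (k + int j)) [0..<n] = cyc_window n w ?i"
    by (simp add: cyc_window_conv_cyc_nth)
  moreover have "?i < length w" using l by (simp add: nat_less_iff)
  ultimately show ?thesis by (auto simp: cyc_sub_def)
qed

section \<open>Periodic reduction\<close>

lemma nth_concat_replicate:
  assumes "i < m * length xs"
  shows "concat (replicate m xs) ! i = xs ! (i mod length xs)"
  using assms
proof (induction m arbitrary: i)
  case 0
  then show ?case by simp
next
  case (Suc m)
  then show ?case
    by (cases "i < length xs") (auto simp: nth_append le_mod_geq not_less)
qed

text \<open>Turns the power condition inside \<open>pr\<close> into a period of the bi-infinite
  word, where subgroup arguments apply.\<close>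

lemma eq_concat_replicate_iff:
  assumes "0 < p" "p dvd length w" "w \<noteq> []"
  shows "w = concat (replicate (length w div p) (take p w)) \<longleftrightarrow> has_period (cyc_nth w) (int p)"
proof -
  let ?l = "length w"
  have pl: "p \<le> ?l" using assms by (simp add: dvd_imp_le)
  then have lt: "length (take p w) = p" by simp
  have len: "length (concat (replicate (?l div p) (take p w))) = ?l"
    using assms pl by (simp add: length_concat sum_list_replicate min_absorb2)
  have nth: "concat (replicate (?l div p) (take p w)) ! i = w ! (i mod p)" if "i < ?l" for i
    using nth_concat_replicate[of i "?l div p" "take p w"] that assms lt by simp
  have "w = concat (replicate (?l div p) (take p w)) \<longleftrightarrow> (\<forall>i<?l. w ! i = w ! (i mod p))"
    using len nth by (metis nth_equalityI)
  also have "\<dots> \<longleftrightarrow> has_period (cyc_nth w) (int p)"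
  proof
    assume eq: "\<forall>i<?l. w ! i = w ! (i mod p)"
    have "cyc_nth w k = w ! nat (k mod int p)" for k
    proof -
      have "nat (k mod int ?l) < ?l" using assms(3) by (simp add: nat_less_iff)
      then have "cyc_nth w k = w ! (nat (k mod int ?l) mod p)" using eq by (simp add: cyc_nth_def)
      also have "nat (k mod int ?l) mod p = nat (k mod int ?l mod int p)"
        using assms(3) by (simp add: nat_mod_distrib)
      also have "k mod int ?l mod int p = k mod int p"
        using assms by (simp add: mod_mod_cancel)
      finally show ?thesis .
    qed
    then show "has_period (cyc_nth w) (int p)" by (simp add: has_period_def)
  next
    assume "has_period (cyc_nth w) (int p)"
    then have "cyc_nth w (int i mod int p) = cyc_nth w (int i)" for i by (rule has_period_mod)
    moreover have "i mod p < ?l" for i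
      using assms pl by (meson mod_less_divisor less_le_trans)
    ultimately show "\<forall>i<?l. w ! i = w ! (i mod p)"
      by (metis cyc_nth_of_nat zmod_int)
  qed
  finally show ?thesis .
qed

lemma pr_least_period:
  assumes "w \<noteq> []"
  shows "0 < length (pr w)" "length (pr w) \<le> length w" "has_period (cyc_nth w) (int (length (pr w)))"
    and "pr w = take (length (pr w)) w"
    and "\<And>d. 0 < d \<Longrightarrow> d dvd length w \<Longrightarrow> has_period (cyc_nth w) (int d) \<Longrightarrow> length (pr w) \<le> d"
proof -
  let ?P = "\<lambda>p. 0 < p \<and> p dvd length w \<and>
    w = concat (replicate (length w div p) (take p w))"
  define p where "p = (LEAST p. ?P p)"
  have "?P (length w)" using assms by simp
  then have P: "?P p" unfolding p_def by (rule LeastI)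
  then have "p \<le> length w" using assms by (simp add: dvd_imp_le)
  moreover have pr: "pr w = take p w" by (simp add: pr_def p_def)
  ultimately have l: "length (pr w) = p" by simp
  show "0 < length (pr w)" "length (pr w) \<le> length w" using P l \<open>p \<le> length w\<close> by auto
  show "has_period (cyc_nth w) (int (length (pr w)))" using P l eq_concat_replicate_iff[of p w] assms by auto
  show "pr w = take (length (pr w)) w" using pr l by simp
  fix d assume "0 < d" "d dvd length w" "has_period (cyc_nth w) (int d)"
  then have "?P d" using eq_concat_replicate_iff[of d w] assms by auto
  then show "length (pr w) \<le> d" unfolding l p_def by (rule Least_le)
qed

text \<open>A word and its reduction unroll to the same bi-infinite word, so either may stand for
  the other in statements about windows.\<close>

lemma cyc_nth_pr:
  assumes "w \<noteq> []"
  shows "cyc_nth (pr w) k = cyc_nth w k"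
proof -
  let ?p = "int (length (pr w))"
  note P = pr_least_period[OF assms]
  have b: "0 \<le> k mod ?p" "k mod ?p < ?p" using P(1) by simp_all
  have "cyc_nth (pr w) k = w ! nat (k mod ?p)"
    unfolding cyc_nth_def using b P(4) by (metis nat_less_iff nth_take)
  also have "\<dots> = cyc_nth w (k mod ?p)" using b P(2) by (simp add: cyc_nth_nth)
  also have "\<dots> = cyc_nth w k" by (rule has_period_mod[OF P(3)])
  finally show ?thesis .
qed

text \<open>\<open>pr\<close> minimises only over divisors of the length; taking the gcd with the
  length turns an arbitrary nonzero period into such a divisor.\<close>

lemma length_pr_le_period:
  assumes "w \<noteq> []" "has_period (cyc_nth w) d" "d \<noteq> 0"
  shows "int (length (pr w)) \<le> \<bar>d\<bar>"
proof -
  let ?g = "nat (gcd d (int (length w)))"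
  have "has_period (cyc_nth w) (int ?g)" using has_period_gcd[OF assms(2) has_period_length] by simp
  moreover have "?g dvd length w" by (simp add: nat_dvd_iff)
  moreover have "0 < ?g" using assms(3) by simp
  ultimately have "length (pr w) \<le> ?g" using pr_least_period(5)[OF assms(1)] by blast
  moreover have "gcd d (int (length w)) \<le> \<bar>d\<bar>"
    using zdvd_imp_le[of "gcd d (int (length w))" "\<bar>d\<bar>"] assms(3) by simp
  ultimately show ?thesis by linarith
qed

text \<open>If the reduced length were at most \<open>j\<close>, reducing \<open>j\<close> modulo it
  would give an earlier position carrying the same letter 1.\<close>

lemma less_length_pr:
  assumes "w \<noteq> []" "\<And>k. k < j \<Longrightarrow> \<not> cyc_nth w (int k)" "cyc_nth w (int j)"
  shows "j < length (pr w)"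
proof (rule ccontr)
  assume "\<not> j < length (pr w)"
  moreover have "0 < length (pr w)" using pr_least_period(1)[OF assms(1)] .
  ultimately have "j mod length (pr w) < j"
    by (metis less_le_trans mod_less_divisor not_less)
  then have "\<not> cyc_nth w (int (j mod length (pr w)))" by (rule assms(2))
  then show False
    using assms(3) has_period_mod[OF pr_least_period(3)[OF assms(1)], of "int j"]
    by (simp add: zmod_int)
qed

section \<open>Cycle joining\<close>

text \<open>The two cycles share a word of \<open>a\<close> letters before the seam and
  \<open>j\<close> letters after it. In \<open>W @ V\<close> the block \<open>V\<close> is preceded
  by the end of \<open>W\<close> and followed cyclically by its beginning. By \<open>stop\<close>
  and \<open>start\<close> these look like the surroundings of \<open>V\<close> in its own cycle,
  and symmetrically for \<open>W\<close>.\<close>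

lemma
  fixes W V :: "bool list" and a j :: nat
  assumes W: "a \<le> length W" "j \<le> length W" and V: "j \<le> length V" "V \<noteq> []"
    and start: "\<And>k. k < j \<Longrightarrow> W ! k = V ! k"
    and stop: "\<And>k. - int a \<le> k \<Longrightarrow> k < 0 \<Longrightarrow> cyc_nth W k = cyc_nth V k"
  shows cyc_nth_append_right: "\<And>k. - int a \<le> k \<Longrightarrow> k < int (length V + j) \<Longrightarrow>
      cyc_nth (W @ V) (int (length W) + k) = cyc_nth V k"
    and cyc_nth_append_left: "\<And>k. - int a \<le> k \<Longrightarrow> k < int (length W + j) \<Longrightarrow>
      cyc_nth (W @ V) k = cyc_nth W k"
proof -
  let ?U = "W @ V" and ?N = "int (length W)" and ?p = "int (length V)"
  have per: "cyc_nth ?U (k + (?N + ?p)) = cyc_nth ?U k" for k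
    using has_periodD[OF has_period_length, of ?U k] by simp
  have perW: "cyc_nth W (k + ?N) = cyc_nth W k" for k
    by (rule has_periodD[OF has_period_length])
  have perV: "cyc_nth V (k + ?p) = cyc_nth V k" for k
    by (rule has_periodD[OF has_period_length])
  have U1: "cyc_nth ?U k = cyc_nth W k" if "0 \<le> k" "k < ?N" for k
    using that by (simp add: cyc_nth_nth nth_append nat_less_iff)
  have U2: "cyc_nth ?U (?N + k) = cyc_nth V k" if "0 \<le> k" "k < ?p" for k
    using that by (simp add: cyc_nth_nth nth_append nat_add_distrib)
  have st: "cyc_nth W k = cyc_nth V k" if "0 \<le> k" "k < int j" for k
    using that W V start[of "nat k"] by (simp add: cyc_nth_nth)
  show right: "cyc_nth ?U (?N + k) = cyc_nth V k" if k: "- int a \<le> k" "k < int (length V + j)" for k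
  proof -
    consider "k < 0" | "0 \<le> k" "k < ?p" | "?p \<le> k" by linarith
    then show ?thesis
    proof cases
      case 1
      then have "cyc_nth ?U (?N + k) = cyc_nth W (k + ?N)"
        using U1[of "?N + k"] k W by (simp add: add.commute)
      then show ?thesis using stop[OF k(1) 1] perW by simp
    next
      case 2
      then show ?thesis by (rule U2)
    next
      case 3
      then have "cyc_nth ?U (k - ?p) = cyc_nth V (k - ?p)"
        using U1[of "k - ?p"] st[of "k - ?p"] k W by simp
      then show ?thesis using per[of "k - ?p"] perV[of "k - ?p"] by (simp add: algebra_simps)
    qed
  qed
  show "cyc_nth ?U k = cyc_nth W k" if k: "- int a \<le> k" "k < int (length W + j)" for k
  proof -
    consider "k < 0" | "0 \<le> k" "k < ?N" | "?N \<le> k" by linarith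
    then show ?thesis
    proof cases
      case 1
      \<comment> \<open>\<open>V\<close> may be shorter than \<open>a\<close>, so
        \<open>k + ?p\<close> can still be negative; hence \<open>right\<close> is used here instead
        of \<open>U2\<close>.\<close>
      then have "cyc_nth ?U (?N + (k + ?p)) = cyc_nth V (k + ?p)"
        using k by (intro right) auto
      then show ?thesis
        using per[of k] perV[of k] stop[OF k(1) 1] by (simp add: algebra_simps)
    next
      case 2
      then show ?thesis by (rule U1)
    next
      case 3
      then show ?thesis
        using U2[of "k - ?N"] st[of "k - ?N"] k V perW[of "k - ?N"] by simp
    qed
  qed
qed

text \<open>A stretch of \<open>length w + a + j\<close> letters has room for
  \<open>length w\<close> consecutive starting points of windows of length \<open>a + j + 1\<close>,
  one for each residue.\<close>

lemma cyc_sub_subset_of_long_factor: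
  assumes "U \<noteq> []" "w \<noteq> []"
    and agree: "\<And>k. - int a \<le> k \<Longrightarrow> k < int (length w + j) \<Longrightarrow>
      cyc_nth U (c + k) = cyc_nth w k"
  shows "cyc_sub (a + j + 1) w \<subseteq> cyc_sub (a + j + 1) U"
proof
  let ?l = "int (length w)"
  fix s assume "s \<in> cyc_sub (a + j + 1) w"
  then obtain i where i: "i < length w" "s = cyc_window (a + j + 1) w i"
    by (auto simp: cyc_sub_def)
  have l: "?l > 0" using assms by simp
  \<comment> \<open>The representative of \<open>i\<close> modulo the length whose window lies
    inside the stretch from \<open>- a\<close> to \<open>length w + j\<close>.\<close>
  define k where "k = (int i + int a) mod ?l - int a"
  have kb: "- int a \<le> k" "k < ?l - int a"
    using l by (auto simp: k_def)
  have w: "cyc_nth w (k + b) = cyc_nth w (int i + b)" for b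
  proof -
    have "cyc_nth w (k + b) = cyc_nth w ((int i + int a) mod ?l + (b - int a))"
      by (simp add: k_def algebra_simps)
    also have "\<dots> = cyc_nth w (int i + int a + (b - int a))"
      by (simp only: cyc_nth_def mod_simps)
    finally show ?thesis by simp
  qed
  have "cyc_nth U (c + k + int b) = cyc_nth w (int i + int b)" if "b < a + j + 1" for b
    using agree[of "k + int b"] that kb w[of "int b"] by (simp add: add.assoc)
  then have "s = map (\<lambda>b. cyc_nth U (c + k + int b)) [0..<a + j + 1]"
    unfolding i(2) cyc_window_conv_cyc_nth by (intro map_cong) auto
  then show "s \<in> cyc_sub (a + j + 1) U" using map_cyc_nth_in_cyc_sub[OF assms(1)] by metis
qed

section \<open>Co-necklaces\<close>

lemma coN_iff:
  "w \<in> coN n \<longleftrightarrow> length w = 2 * n \<and> (\<forall>i<n. w ! (n + i) = (\<not> w ! i)) \<and> necklace w"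
proof
  assume "w \<in> coN n"
  then show "length w = 2 * n \<and> (\<forall>i<n. w ! (n + i) = (\<not> w ! i)) \<and> necklace w"
    by (auto simp: coN_def co_necklace_def complement_def nth_append)
next
  assume w: "length w = 2 * n \<and> (\<forall>i<n. w ! (n + i) = (\<not> w ! i)) \<and> necklace w"
  then have "drop n w = complement (take n w)"
    by (intro nth_equalityI) (auto simp: complement_def)
  then have "w = take n w @ complement (take n w)" by (metis append_take_drop_id)
  then show "w \<in> coN n" using w unfolding coN_def co_necklace_def
    by (intro CollectI exI[of _ "take n w"]) auto
qed

lemma cyc_nth_add_half:
  assumes "w \<in> coN n" "0 < n"
  shows "cyc_nth w (k + int n) = (\<not> cyc_nth w k)"
proof -
  define r where "r = nat (k mod int (2 * n))"
  have w: "length w = 2 * n" "\<And>i. i < n \<Longrightarrow> w ! (n + i) = (\<not> w ! i)"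
    using assms(1) by (auto simp: coN_iff)
  have r: "int r = k mod int (2 * n)" "r < 2 * n"
    using assms(2) by (simp_all add: r_def nat_less_iff)
  have k: "cyc_nth w k = w ! r" by (simp add: cyc_nth_def w r_def)
  have "(k + int n) mod int (2 * n) = int ((r + n) mod (2 * n))"
    unfolding zmod_int of_nat_add r(1) by (rule mod_add_left_eq[symmetric])
  then have kn: "cyc_nth w (k + int n) = w ! ((r + n) mod (2 * n))"
    unfolding cyc_nth_def w(1) by simp
  show ?thesis
  proof (cases "r < n")
    case True
    then show ?thesis using k kn w(2)[of r] by (simp add: add.commute)
  next
    case False
    then have "(r + n) mod (2 * n) = r - n" using r(2) by (simp add: mod_if)
    then show ?thesis using k kn w(2)[of "r - n"] False r(2) by simp
  qed
qed

text \<open>A shift by \<open>n\<close> negates both words, so whether they agree at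
  \<open>k\<close> depends only on \<open>k\<close> modulo \<open>n\<close>.\<close>

lemma coN_eq_of_eq_on_window:
  assumes "v \<in> coN n" "w \<in> coN n" "0 < n"
    and "\<And>j. j < n \<Longrightarrow> cyc_nth v (x + int j) = cyc_nth w (y + int j)"
  shows "cyc_nth v (x + k) = cyc_nth w (y + k)"
proof -
  let ?D = "\<lambda>k. cyc_nth v (x + k) = cyc_nth w (y + k)"
  have "has_period ?D (int n)"
    using cyc_nth_add_half[OF assms(1,3)] cyc_nth_add_half[OF assms(2,3)]
    by (auto simp: has_period_def simp flip: add.assoc)
  then have "?D (k mod int n) = ?D k" by (rule has_period_mod)
  moreover have "?D (k mod int n)"
    using assms(4)[of "nat (k mod int n)"] assms(3) by (simp add: nat_less_iff)
  ultimately show ?thesis by simp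
qed

lemma ex_rotate_eq:
  assumes "length v = length w" "w \<noteq> []" "\<And>k. cyc_nth v k = cyc_nth w (d + k)"
  shows "\<exists>m. v = rotate m w"
proof (intro exI nth_equalityI)
  let ?l = "int (length w)"
  show "length v = length (rotate (nat (d mod ?l)) w)" using assms by simp
  fix i assume i: "i < length v"
  have "int ((nat (d mod ?l) + i) mod length w) = (d + int i) mod ?l"
    using assms(2) by (simp add: zmod_int mod_simps)
  then have "nat ((d + int i) mod ?l) = (nat (d mod ?l) + i) mod length w"
    by (metis nat_int)
  then show "v ! i = rotate (nat (d mod ?l)) w ! i"
    using assms(1) assms(3)[of "int i"] i
    by (simp add: nth_rotate cyc_nth_def cyc_nth_of_nat)
qed

text \<open>A common window makes the two words rotations of each other, and both are least among
  their rotations. Once they are equal, \<open>x - y\<close> is a period of absolute value below the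
  reduced length, hence zero.\<close>

lemma coN_window_inj:
  assumes v: "v \<in> coN n" and w: "w \<in> coN n" and "0 < n"
    and eq: "cyc_window n v x = cyc_window n w y"
  shows "v = w" and "x < length (pr v) \<Longrightarrow> y < length (pr w) \<Longrightarrow> x = y"
proof -
  have len: "length v = 2 * n" "length w = 2 * n" using v w by (auto simp: coN_iff)
  then have ne: "v \<noteq> []" "w \<noteq> []" using assms(3) by auto
  have all: "cyc_nth v (int x + k) = cyc_nth w (int y + k)" for k
  proof (rule coN_eq_of_eq_on_window[OF v w assms(3)])
    show "cyc_nth v (int x + int j) = cyc_nth w (int y + int j)" if "j < n" for j
      using eq that by (simp add: cyc_window_conv_cyc_nth)
  qed
  have 1: "cyc_nth v k = cyc_nth w (int y - int x + k)" for k
    using all[of "k - int x"] by (simp add: algebra_simps)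
  have 2: "cyc_nth w k = cyc_nth v (int x - int y + k)" for k
    using all[of "k - int y"] by (simp add: algebra_simps)
  obtain m where "v = rotate m w" using ex_rotate_eq[OF _ ne(2) 1] len by auto
  moreover obtain m' where "w = rotate m' v" using ex_rotate_eq[OF _ ne(1) 2] len by auto
  ultimately have "w \<le> v" "v \<le> w" using v w unfolding coN_iff necklace_def by metis+
  then show vw: "v = w" by simp
  assume xy: "x < length (pr v)" "y < length (pr w)"
  have "has_period (cyc_nth v) (int x - int y)"
    using 2 vw by (simp add: has_period_def add.commute)
  then show "x = y" using length_pr_le_period[OF ne(1)] xy vw by force
qed

lemma list_less_of_first_difference:
  fixes v w :: "bool list"
  assumes "length v = length w" "t < length v" "\<And>i. i < t \<Longrightarrow> v ! i = w ! i" "\<not> v ! t" "w ! t"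
  shows "v < w"
proof -
  have "take t v = take t w" using assms by (intro nth_equalityI) auto
  then show ?thesis using assms
    unfolding list_less_def lexord_take_index_conv by (auto simp: less_bool_def)
qed

text \<open>Cyclic runs of zeros in \<open>w\<close> have length at most \<open>j\<close>, so the flip makes the initial run
  the unique longest one.\<close>

lemma coN_flip_first_one:
  assumes w: "w \<in> coN n" and j: "j < n" "\<And>k. k < j \<Longrightarrow> \<not> w ! k" "w ! j"
  shows "w[j := False, n + j := True] \<in> coN n"
proof -
  define v where "v = w[j := False, n + j := True]"
  have lw: "length w = 2 * n" and half: "\<And>i. i < n \<Longrightarrow> w ! (n + i) = (\<not> w ! i)"
    and nw: "\<And>k. w \<le> rotate k w"
    using w by (auto simp: coN_iff necklace_def)
  have lv: "length v = 2 * n" by (simp add: v_def lw)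
  have nth: "v ! i = (if i = n + j then True else if i = j then False else w ! i)"
    if "i < 2 * n" for i
    using that by (auto simp: v_def lw nth_list_update)
  have vhalf: "\<forall>i<n. v ! (n + i) = (\<not> v ! i)"
    using j half by (auto simp: nth)
  have vzero: "\<not> v ! i" if "i \<le> j" for i using that j by (auto simp: nth)
  \<comment> \<open>The length of the initial zero run of \<open>v\<close>. Every proper rotation is
    shown to have a 1 before position \<open>r\<close>, which makes it larger than
    \<open>v\<close>.\<close>
  define r where "r = (LEAST r. v ! r)"
  have "v ! n" using vhalf vzero[of 0] j by (metis add.right_neutral le0 le_less_trans)
  then have r: "v ! r" "r \<le> n" "\<And>i. i < r \<Longrightarrow> \<not> v ! i"
    unfolding r_def by (auto intro: LeastI Least_le dest: not_less_Least)
  then have jr: "j < r" using vzero not_less by blast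
  have run: "\<exists>t\<le>j. w ! ((k + t) mod (2 * n))" for k
  proof (rule ccontr)
    assume "\<not> ?thesis"
    then have "\<not> rotate k w ! t" if "t \<le> j" for t
      using that j lw by (simp add: nth_rotate)
    then have "rotate k w < w"
      using j lw by (intro list_less_of_first_difference[of _ _ j]) auto
    then show False using nw[of k] by simp
  qed
  have "v \<le> rotate k v" for k
  proof -
    define l where "l = k mod (2 * n)"
    have rot: "rotate k v = rotate l v" using rotate_conv_mod[of k v] by (simp add: l_def lv)
    have l: "l < 2 * n" using j by (simp add: l_def)
    show ?thesis
    proof (cases "l = 0")
      case True
      then show ?thesis using rot by simp
    next
      case False
      have "\<exists>t<r. rotate l v ! t"
      proof (cases "l \<le> j")
        case True
        \<comment> \<open>The rotation starts inside the initial run and meets the end of that run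
          too early.\<close>
        then have "rotate l v ! (r - l)"
          using r jr lv j by (simp add: nth_rotate)
        then show ?thesis using False True jr by (intro exI[of _ "r - l"]) auto
      next
        case lj: False
        obtain t where t: "t \<le> j" "w ! ((l + t) mod (2 * n))" using run by blast
        have b: "(l + t) mod (2 * n) < 2 * n" using j by simp
        \<comment> \<open>The only 1 of \<open>w\<close> erased in \<open>v\<close> is at
          \<open>j\<close>. As \<open>j < l < 2 * n\<close> and \<open>t <= j\<close>, the sum
          \<open>l + t\<close> lies strictly between \<open>j\<close> and \<open>2 * n + j\<close>,
          so it misses that position.\<close>
        have "(l + t) mod (2 * n) \<noteq> j" using l lj t(1) j by (auto simp: mod_if)
        then have "v ! ((l + t) mod (2 * n))" using t(2) nth[OF b] by auto
        then have "rotate l v ! t" using t(1) j lv by (simp add: nth_rotate)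
        then show ?thesis using t(1) jr by (intro exI[of _ t]) auto
      qed
      then obtain t0 where t0: "t0 < r" "rotate l v ! t0" by blast
      define t where "t = (LEAST t. rotate l v ! t)"
      have t: "rotate l v ! t" "t \<le> t0" "\<And>i. i < t \<Longrightarrow> \<not> rotate l v ! i"
        using t0(2) unfolding t_def by (auto intro: LeastI Least_le dest: not_less_Least)
      have "v < rotate l v"
        using t t0 r lv by (intro list_less_of_first_difference[of _ _ t]) auto
      then show ?thesis using rot by simp
    qed
  qed
  then show ?thesis using lv vhalf unfolding v_def[symmetric] coN_iff necklace_def by blast
qed

text \<open>The larger of the two touched positions turns from 0 into 1, so the flipped word comes
  earlier in the reverse order.\<close>

lemma colex_less_flip_first_one:
  assumes "length w = 2 * n" "j < n" "\<not> w ! (n + j)"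
  shows "colex_less w (w[j := False, n + j := True])"
  using assms unfolding colex_less_def
  by (intro conjI exI[of _ "n + j"]) (auto simp: nth_list_update)

lemma colex_less_asym: "colex_less v w \<Longrightarrow> \<not> colex_less w v"
  using colex_less_iff_rev[of v w] colex_less_iff_rev[of w v]
  by (auto simp: colex_less_def[of v w])

text \<open>Starting with \<open>n\<close> zeros would force \<open>v\<close> to be
  \<open>0^n 1^n\<close>, the colexicographic maximum of \<open>coN n\<close>. The 1 found here
  makes the flip available.\<close>

lemma ex_first_one_of_colex_less:
  assumes v: "v \<in> coN n" and w: "w \<in> coN n" and less: "colex_less v w"
  shows "\<exists>k<n. v ! k"
proof (rule ccontr)
  assume z: "\<not> ?thesis"
  have lv: "length v = 2 * n" and hv: "\<And>i. i < n \<Longrightarrow> v ! (n + i) = (\<not> v ! i)"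
    and hw: "\<And>i. i < n \<Longrightarrow> w ! (n + i) = (\<not> w ! i)"
    using v w by (auto simp: coN_iff)
  obtain i where i: "i < 2 * n" "\<not> v ! i" "w ! i" "\<And>k. i < k \<Longrightarrow> k < 2 * n \<Longrightarrow> v ! k = w ! k"
    using less lv by (auto simp: colex_less_def)
  show False
  proof (cases "i < n")
    case True
    then show ?thesis using i(3) i(4)[of "n + i"] hv[of i] hw[of i] z by auto
  next
    case False
    then have "i - n < n" using i(1) by simp
    then show ?thesis using hv[of "i - n"] i(2) z False by auto
  qed
qed

section \<open>The reverse colexicographic listing\<close>

lemma rev_colex_listing_less:
  assumes "rev_colex_listing A L" "x < y" "y < length L"
  shows "colex_less (L ! y) (L ! x)"
  using assms by (auto simp: rev_colex_listing_def sorted_wrt_iff_nth_less)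

lemma rev_colex_listing_nth:
  assumes "rev_colex_listing A L" "x < length L"
  shows "L ! x \<in> A"
  using assms nth_mem by (auto simp: rev_colex_listing_def)

lemma rev_colex_listing_distinct:
  assumes "rev_colex_listing A L"
  shows "distinct L"
  unfolding distinct_conv_nth
  using rev_colex_listing_less[OF assms] colex_less_asym by (metis nat_neq_iff)

text \<open>A 1 in the first half could be flipped, giving an element that precedes the first
  one.\<close>

lemma rev_colex_listing_hd:
  assumes L: "rev_colex_listing (coN n) L" "L \<noteq> []" and k: "k < n"
  shows "\<not> L ! 0 ! k"
proof
  assume one: "L ! 0 ! k"
  have w: "L ! 0 \<in> coN n" using rev_colex_listing_nth[OF L(1), of 0] L(2) by simp
  define j where "j = (LEAST j. L ! 0 ! j)"
  have j: "L ! 0 ! j" "j \<le> k" "\<And>i. i < j \<Longrightarrow> \<not> L ! 0 ! i"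
    using one unfolding j_def by (auto intro: LeastI Least_le dest: not_less_Least)
  let ?v = "(L ! 0)[j := False, n + j := True]"
  have "?v \<in> coN n" using w j k by (intro coN_flip_first_one) auto
  then obtain i where i: "i < length L" "?v = L ! i"
    using L by (metis rev_colex_listing_def in_set_conv_nth)
  have "colex_less (L ! 0) ?v"
    using w j k by (intro colex_less_flip_first_one) (auto simp: coN_iff)
  then show False
    using i colex_less_asym rev_colex_listing_less[OF L(1), of 0 i] by (metis not_gr_zero)
qed

text \<open>Colexicographically, the predecessor lies above \<open>L ! Suc x\<close> and at most at
  its flip. These two bounds agree beyond position \<open>n + j\<close>, so everything between them
  agrees with them there.\<close>

lemma rev_colex_listing_consecutive:
  assumes L: "rev_colex_listing (coN n) L" and x: "Suc x < length L"
  obtains j where "j < n" "\<And>k. k < j \<Longrightarrow> \<not> L ! Suc x ! k" "L ! Suc x ! j"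
    "\<And>q. n + j < q \<Longrightarrow> q < 2 * n \<Longrightarrow> L ! x ! q = L ! Suc x ! q"
proof -
  let ?u = "L ! x" and ?w = "L ! Suc x"
  have u: "?u \<in> coN n" and w: "?w \<in> coN n" using rev_colex_listing_nth[OF L] x by simp_all
  have lw: "length ?w = 2 * n" using w by (simp add: coN_iff)
  have less: "colex_less ?w ?u" using rev_colex_listing_less[OF L] x by simp
  obtain k where k: "k < n" "?w ! k" using ex_first_one_of_colex_less[OF w u less] by blast
  define j where "j = (LEAST j. ?w ! j)"
  have j: "?w ! j" "j \<le> k" "\<And>i. i < j \<Longrightarrow> \<not> ?w ! i"
    using k(2) unfolding j_def by (auto intro: LeastI Least_le dest: not_less_Least)
  have jn: "j < n" using j k by simp
  let ?v = "?w[j := False, n + j := True]"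
  have v: "?v \<in> coN n" using w j jn by (intro coN_flip_first_one) auto
  have wv: "colex_less ?w ?v"
    using w j jn by (intro colex_less_flip_first_one) (auto simp: coN_iff)
  obtain y where y: "y < length L" "?v = L ! y"
    using L v by (metis rev_colex_listing_def in_set_conv_nth)
  have "y < Suc x"
  proof (rule ccontr)
    assume "\<not> y < Suc x"
    then have "y = Suc x \<or> Suc x < y" by auto
    then show False
      using wv y colex_less_asym rev_colex_listing_less[OF L, of "Suc x" y] by metis
  qed
  then have "y = x \<or> y < x" by auto
  then have nless: "\<not> colex_less ?v ?u"
    using y x colex_less_asym rev_colex_listing_less[OF L, of y x] by (metis Suc_lessD)
  obtain i where i: "i < 2 * n" "?w ! i < ?u ! i" "\<And>q. i < q \<Longrightarrow> q < 2 * n \<Longrightarrow> ?w ! q = ?u ! q"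
    using less lw by (auto simp: colex_less_def)
  have "i \<le> n + j"
  proof (rule ccontr)
    assume "\<not> i \<le> n + j"
    \<comment> \<open>Beyond \<open>n + j\<close> the flip coincides with \<open>?w\<close>, so a
      last difference there would also put the flip below \<open>?u\<close>.\<close>
    then have "colex_less ?v ?u"
      using i lw u unfolding colex_less_def
      by (intro conjI exI[of _ i]) (auto simp: coN_iff)
    then show False using nless by simp
  qed
  then show thesis using that[of j] jn j i(3) by force
qed

section \<open>Building the cycle by prefixes and counting its windows\<close>

lemma UC_take_Suc: "i < length L \<Longrightarrow> UC (take (Suc i) L) = UC (take i L) @ pr (L ! i)"
  by (simp add: UC_def take_Suc_conv_app_nth)

lemma cyc_sub_subset_pr:
  assumes "w \<noteq> []"
  shows "cyc_sub n w \<subseteq> cyc_sub n (pr w)"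
proof
  fix s assume "s \<in> cyc_sub n w"
  then obtain i where "s = map (\<lambda>j. cyc_nth (pr w) (int i + int j)) [0..<n]"
    using assms by (auto simp: cyc_sub_def cyc_window_conv_cyc_nth cyc_nth_pr)
  moreover have "pr w \<noteq> []" using pr_least_period(1)[OF assms] by auto
  ultimately show "s \<in> cyc_sub n (pr w)" using map_cyc_nth_in_cyc_sub by blast
qed

text \<open>The initial zeros supply the letters after the seam in the next join. The third clause
  says that the cycle ends like the word appended last, so comparing consecutive list entries
  supplies the letters before the seam.\<close>

lemma UC_prefix_invariant:
  assumes L: "rev_colex_listing (coN n) L" and n: "0 < n" and "i < length L"
  defines "W \<equiv> \<lambda>i. UC (take (Suc i) L)"
  shows "n \<le> length (W i) \<and> (\<forall>k<n. \<not> W i ! k) \<and>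
    (\<forall>k. - int n < k \<and> k < 0 \<longrightarrow> cyc_nth (W i) k = cyc_nth (L ! i) k) \<and>
    (\<forall>w\<in>set (take (Suc i) L). cyc_sub n w \<subseteq> cyc_sub n (W i))"
  using \<open>i < length L\<close>
proof (induction i)
  case 0
  let ?w = "L ! 0"
  have w: "?w \<in> coN n" using rev_colex_listing_nth[OF L 0] .
  then have lw: "length ?w = 2 * n" by (simp add: coN_iff)
  then have ne: "?w \<noteq> []" using n by auto
  have W: "W 0 = pr ?w" using 0 by (cases L) (auto simp: W_def UC_def)
  have zero: "\<not> cyc_nth ?w (int k)" if "k < n" for k
    using that rev_colex_listing_hd[OF L, of k] 0 lw by (auto simp: cyc_nth_of_nat)
  moreover have "cyc_nth ?w (int n)"
    using cyc_nth_add_half[OF w n, of 0] zero[of 0] n by simp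
  ultimately have len: "n < length (pr ?w)" using less_length_pr[OF ne] by blast
  have "\<not> pr ?w ! k" if "k < n" for k
    using zero[OF that] that len cyc_nth_of_nat[of k "pr ?w"] cyc_nth_pr[OF ne] by simp
  moreover have "set (take (Suc 0) L) = {?w}" using 0 by (cases L) auto
  ultimately show ?case using len cyc_sub_subset_pr[OF ne] W cyc_nth_pr[OF ne] by simp
next
  case (Suc i)
  let ?u = "L ! i" and ?w = "L ! Suc i"
  let ?W = "W i" and ?V = "pr ?w"
  from Suc have IH: "n \<le> length ?W" "\<And>k. k < n \<Longrightarrow> \<not> ?W ! k"
    "\<And>k. - int n < k \<Longrightarrow> k < 0 \<Longrightarrow> cyc_nth ?W k = cyc_nth ?u k"
    "\<And>w. w \<in> set (take (Suc i) L) \<Longrightarrow> cyc_sub n w \<subseteq> cyc_sub n ?W"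
    by auto
  have u: "?u \<in> coN n" and w: "?w \<in> coN n" using rev_colex_listing_nth[OF L] Suc.prems by simp_all
  have lu: "length ?u = 2 * n" and lw: "length ?w = 2 * n" using u w by (auto simp: coN_iff)
  then have ne: "?w \<noteq> []" using n by auto
  have W: "W (Suc i) = ?W @ ?V" unfolding W_def by (rule UC_take_Suc[OF Suc.prems])
  obtain j where j: "j < n" "\<And>k. k < j \<Longrightarrow> \<not> ?w ! k" "?w ! j"
    and agree: "\<And>q. n + j < q \<Longrightarrow> q < 2 * n \<Longrightarrow> ?u ! q = ?w ! q"
    by (rule rev_colex_listing_consecutive[OF L Suc.prems]) blast
  \<comment> \<open>The \<open>j\<close> zeros after the seam and \<open>a\<close> letters before it
    make up a shared word of length \<open>n - 1\<close>.\<close>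
  define a where "a = n - 1 - j"
  have n_eq: "n = a + j + 1" using j(1) by (simp add: a_def)
  have zero: "\<not> cyc_nth ?w (int k)" if "k < j" for k
    using that j lw by (simp add: cyc_nth_of_nat)
  have "cyc_nth ?w (int j)" using j lw by (simp add: cyc_nth_of_nat)
  then have len: "j < length ?V" using less_length_pr[OF ne] zero by blast
  have start: "?W ! k = ?V ! k" if "k < j" for k
    using zero[OF that] that len cyc_nth_of_nat[of k ?V] cyc_nth_pr[OF ne] IH(2) j(1) by simp
  have stop: "cyc_nth ?W k = cyc_nth ?V k" if k: "- int a \<le> k" "k < 0" for k
  proof -
    let ?q = "nat (k + int (2 * n))"
    \<comment> \<open>Counted from the end of a word of length \<open>2 * n\<close>, the last
      \<open>a\<close> positions are exactly those beyond \<open>n + j\<close>.\<close>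
    have q: "n + j < ?q" "?q < 2 * n" using k n_eq by auto
    have "cyc_nth ?u k = ?u ! ?q"
      using has_periodD[OF has_period_length, of ?u k] lu q cyc_nth_nth[of "k + int (2 * n)" ?u]
      by simp
    moreover have "cyc_nth ?w k = ?w ! ?q"
      using has_periodD[OF has_period_length, of ?w k] lw q cyc_nth_nth[of "k + int (2 * n)" ?w]
      by simp
    ultimately show ?thesis using agree[OF q] IH(3)[of k] k n_eq cyc_nth_pr[OF ne] by simp
  qed
  have prems: "a \<le> length ?W" "j \<le> length ?W" "j \<le> length ?V" "?V \<noteq> []"
    using IH(1) n_eq len by auto
  note right = cyc_nth_append_right[OF prems start stop]
  note left = cyc_nth_append_left[OF prems start stop]
  have neW: "?W \<noteq> []" using IH(1) n by auto
  have "cyc_sub n ?W \<subseteq> cyc_sub n (?W @ ?V)"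
    unfolding n_eq using left neW
    by (intro cyc_sub_subset_of_long_factor[where c = 0]) auto
  moreover have "cyc_sub n ?V \<subseteq> cyc_sub n (?W @ ?V)"
    unfolding n_eq using right neW prems(4)
    by (intro cyc_sub_subset_of_long_factor[where c = "int (length ?W)"]) auto
  moreover have "set (take (Suc (Suc i)) L) = insert ?w (set (take (Suc i) L))"
    using Suc.prems by (simp add: take_Suc_conv_app_nth insert_commute)
  ultimately have "\<forall>w\<in>set (take (Suc (Suc i)) L). cyc_sub n w \<subseteq> cyc_sub n (?W @ ?V)"
    using IH(4) cyc_sub_subset_pr[OF ne, of n] by (metis insert_iff order_trans)
  moreover have "cyc_nth (?W @ ?V) k = cyc_nth ?w k" if k: "- int n < k" "k < 0" for k
  proof -
    have "cyc_nth (?W @ ?V) k = cyc_nth (?W @ ?V) (int (length ?W) + (k + int (length ?V)))"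
      using has_periodD[OF has_period_length, of "?W @ ?V" k] by (simp add: algebra_simps)
    also have "\<dots> = cyc_nth ?V (k + int (length ?V))"
      \<comment> \<open>\<open>?V\<close> may have fewer than \<open>n - 1\<close> letters, but it
        has more than \<open>j\<close>, so \<open>k + length ?V\<close> is at least
        \<open>- a\<close>, within reach of \<open>right\<close>.\<close>
      using k n_eq len by (intro right) auto
    also have "\<dots> = cyc_nth ?V k" by (rule has_periodD[OF has_period_length])
    finally show ?thesis using cyc_nth_pr[OF ne] by simp
  qed
  ultimately show ?case using IH(1,2) by (simp add: W nth_append)
qed

text \<open>Counting starting positions inside each \<open>pr w\<close> bounds the length from
  above; the reverse inequality will come from coverage.\<close>

lemma length_UC_le_card:
  assumes "set A \<subseteq> coN n" "distinct A" "0 < n"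
  shows "length (UC A) \<le> card (\<Union>w\<in>set A. cyc_sub n w)"
proof -
  have "length (pr w) \<le> card (cyc_sub n w)" if "w \<in> set A" for w
  proof -
    have w: "w \<in> coN n" using that assms(1) by auto
    then have "w \<noteq> []" using assms(3) by (auto simp: coN_iff)
    then have "cyc_window n w ` {..<length (pr w)} \<subseteq> cyc_sub n w"
      using pr_least_period(2)[of w] by (auto simp: cyc_sub_def)
    moreover have "inj_on (cyc_window n w) {..<length (pr w)}"
      using coN_window_inj(2)[OF w w assms(3)] by (auto intro: inj_onI)
    ultimately show ?thesis
      using card_inj_on_le[of "cyc_window n w" "{..<length (pr w)}" "cyc_sub n w"]
      by (simp add: cyc_sub_def)
  qed
  then have "(\<Sum>w\<in>set A. length (pr w)) \<le> (\<Sum>w\<in>set A. card (cyc_sub n w))"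
    by (rule sum_mono)
  also have "\<dots> = card (\<Union>w\<in>set A. cyc_sub n w)"
  proof (rule card_UN_disjoint[symmetric])
    have "v = w" if "v \<in> set A" "w \<in> set A" "s \<in> cyc_sub n v" "s \<in> cyc_sub n w" for v w s
      using that coN_window_inj(1)[OF _ _ assms(3)] assms(1)
      unfolding cyc_sub_def by (metis imageE subsetD)
    then show "\<forall>v\<in>set A. \<forall>w\<in>set A. v \<noteq> w \<longrightarrow> cyc_sub n v \<inter> cyc_sub n w = {}" by blast
  qed (auto simp: cyc_sub_def)
  also have "(\<Sum>w\<in>set A. length (pr w)) = length (UC A)"
    using assms(2) by (simp add: UC_def length_concat comp_def sum_list_distinct_conv_sum_set)
  finally show ?thesis .
qed

theorem theorem5:
  fixes n m :: nat and L \<alpha>s :: "bool list list"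
  assumes "n \<ge> 2" and "1 \<le> m" and "m \<le> card (coN n)"
    and "rev_colex_listing (coN n) L"
    and "\<alpha>s = take m L"
  shows "universal_cycle n (\<Union>\<alpha>\<in>set \<alpha>s. cyc_sub n \<alpha>) (UC \<alpha>s)"
proof -
  let ?S = "\<Union>\<alpha>\<in>set \<alpha>s. cyc_sub n \<alpha>" and ?W = "UC \<alpha>s"
  have n: "0 < n" using assms(1) by simp
  have dist: "distinct L" and set: "set L = coN n"
    using rev_colex_listing_distinct[OF assms(4)] assms(4) by (auto simp: rev_colex_listing_def)
  then have m: "m \<le> length L" using assms(3) by (metis distinct_card)
  obtain i where i: "m = Suc i" "i < length L" using assms(2) m by (cases m) auto
  have inv: "n \<le> length ?W" "?S \<subseteq> cyc_sub n ?W"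
    using UC_prefix_invariant[OF assms(4) n i(2)] i(1) assms(5) by auto
  have sub: "set \<alpha>s \<subseteq> coN n" using set assms(5) by (auto dest: in_set_takeD)
  have le: "length ?W \<le> card ?S"
    using length_UC_le_card[OF sub _ n] dist assms(5) by simp
  have fin: "finite (cyc_sub n ?W)" by (simp add: cyc_sub_def)
  have card: "card (cyc_sub n ?W) \<le> length ?W"
    unfolding cyc_sub_def using card_image_le[of "{..<length ?W}"] by simp
  \<comment> \<open>The chain
    \<open>length ?W <= card ?S <= card (cyc_sub n ?W) <= length ?W\<close> collapses. Equality of
    the last two terms makes the window map injective, which gives uniqueness of
    occurrences.\<close>
  have eq: "?S = cyc_sub n ?W" using card_seteq[OF fin inv(2)] le card by simp
  then have len: "length ?W = card ?S" using le card by simp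
  have inj: "inj_on (cyc_window n ?W) {..<length ?W}"
    using len eq by (intro eq_card_imp_inj_on) (auto simp: cyc_sub_def)
  have "\<exists>!x. x < length ?W \<and> cyc_window n ?W x = s" if "s \<in> ?S" for s
  proof -
    have "s \<in> cyc_sub n ?W" using that unfolding eq .
    then show ?thesis using inj by (auto simp: cyc_sub_def inj_on_def)
  qed
  moreover have "?S \<noteq> {}" using len inv(1) n by (metis card.empty less_le_trans less_numeral_extra(3))
  moreover have "?S \<subseteq> {s. length s = n}" by (auto simp: cyc_sub_def cyc_window_def)
  ultimately show ?thesis using len unfolding universal_cycle_def by blast
qed

end
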